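(* Let $P$ be a set of $n$ points in general position in the plane and let $0\le l<k\le n$ be integers. If $n>(k-l)(k-l+1)+k$, then the generalized island Johnson graph $IJ(P,k,l)$ is connected and its diameter is $O\!\left(\frac{n}{k-l}\right)+O(k-l)$.
   Context: General position means no three points of $P$ are collinear. A subset $I\subseteq P$ is an island of $P$ if there is a convex set $C$ with $I=P\cap C$; a $k$-island is an island with exactly $k$ elements. For integers $0\le l<k\le n$, $IJ(P,k,l)$ is the graph whose vertices are the $k$-islands of $P$, two of them adjacent if their intersection has exactly $l$ elements. The diameter is the maximum graph distance between two vertices. The implied constants in the $O$-notation are absolute (independent of $P,n,k,l$). *)

theory Defs
  imports "HOL-Analysis.Analysis" "Graph_Theory.Graph_Theory"
begin

definition general_position :: "(real^2) set \<Rightarrow> bool" where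
  "general_position P \<longleftrightarrow> (\<forall>T\<subseteq>P. card T = 3 \<longrightarrow> \<not> collinear T)"

definition island :: "(real^2) set \<Rightarrow> (real^2) set \<Rightarrow> bool" where
  "island P I \<longleftrightarrow> (\<exists>C. convex C \<and> I = P \<inter> C)"

definition k_islands :: "(real^2) set \<Rightarrow> nat \<Rightarrow> (real^2) set set" where
  "k_islands P k = {I. island P I \<and> card I = k}"

text \<open>An undirected graph is represented by its symmetric set of arcs.\<close>

definition island_johnson_graph ::
    "(real^2) set \<Rightarrow> nat \<Rightarrow> nat \<Rightarrow> (real^2) set pair_pre_digraph" where
  "island_johnson_graph P k l =
     \<lparr> pverts = k_islands P k,
       parcs = {(I, J). I \<in> k_islands P k \<and> J \<in> k_islands P k \<and> card (I \<inter> J) = l} \<rparr>"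

lemma pair_graph_island_johnson_graph:
  assumes "finite P" and "l < k"
  shows "pair_graph (island_johnson_graph P k l)"
proof -
  have fin: "finite (k_islands P k)"
    by (rule finite_subset[of _ "Pow P"]) (use assms in \<open>auto simp: k_islands_def island_def\<close>)
  have "finite {(I, J). I \<in> k_islands P k \<and> J \<in> k_islands P k \<and> card (I \<inter> J) = l}"
    by (rule finite_subset[of _ "k_islands P k \<times> k_islands P k"]) (use fin in auto)
  moreover have "card I = k" if "I \<in> k_islands P k" for I
    using that by (simp add: k_islands_def)
  ultimately show ?thesis
    using assms fin
    by unfold_locales
      (auto simp: island_johnson_graph_def symmetric_def Int_commute intro!: symI)
qed

text \<open>
  With unit arc weights, the shortest-path cost \<open>\<mu>\<close> is the graph distance (infinite if there is no
  walk). Its definition unfolds only for well-formed digraphs, which the graphs above are by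
  \<open>pair_graph_island_johnson_graph\<close>. On a finite nonempty graph the supremum is a maximum.
\<close>

definition graph_distance :: "('a, 'b) pre_digraph \<Rightarrow> 'a \<Rightarrow> 'a \<Rightarrow> ereal" where
  "graph_distance G u v = wf_digraph.\<mu> G (\<lambda>_. 1) u v"

definition graph_diameter :: "('a, 'b) pre_digraph \<Rightarrow> ereal" where
  "graph_diameter G = (SUP u\<in>verts G. SUP v\<in>verts G. graph_distance G u v)"

end

theory Submission
  imports Defs
begin

text \<open>
  Let \<open>m = k - l\<close> and order the points along a generic direction. The windows of \<open>k\<close> consecutive
  points are islands, and shifting a window by \<open>m\<close> positions is a step of the graph.

  An arbitrary island reaches a window in \<open>O(n / m)\<close> steps: repeatedly cut off its \<open>m\<close> leftmost points
  and let the rest grow back to \<open>k\<close> points on the right of the cut. When this is no longer possible, the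
  island has more than \<open>l\<close> points in the last window and at most \<open>l\<close> in some other one; the size of the
  intersection changes by at most one when the window moves by one position, so it equals \<open>l\<close> for
  some window.

  Shifts by \<open>m\<close> preserve the position of a window modulo \<open>m\<close>. A window can be moved by one position in
  six steps if there are at least \<open>2m - 1\<close> points on either side: with \<open>S\<close> the union of the two
  windows, one passes through \<open>S - {t}\<close> and \<open>S - {s}\<close>, where the line through \<open>s\<close> and \<open>t\<close>
  supports \<open>S\<close>, \<open>s\<close> is among the first \<open>m\<close> points of \<open>S\<close> and \<open>t\<close> is not. These two islands have
  a common neighbour consisting of points on the side of \<open>S\<close> of this line. The hypothesis
  \<open>n > m(m + 1) + k\<close> leaves room for \<open>m\<close> consecutive positions of this kind, as \<open>(m - 2)\<^sup>2 \<ge> 0\<close>.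
\<close>

section \<open>Walks of bounded length\<close>

text \<open>With relational powers, composing walks just adds their bounds. Walks of the graph
  library enter only when connectivity and the distance bound are deduced.\<close>

definition within_steps :: "('a \<times> 'a) set \<Rightarrow> nat \<Rightarrow> 'a \<Rightarrow> 'a \<Rightarrow> bool" where
  "within_steps E N x y \<longleftrightarrow> (\<exists>r\<le>N. (x, y) \<in> E ^^ r)"

lemma within_steps_refl: "within_steps E 0 x x"
  by (auto simp: within_steps_def)

lemma within_steps_arc: "(x, y) \<in> E \<Longrightarrow> within_steps E 1 x y"
  by (auto simp: within_steps_def intro!: exI[of _ 1])

lemma within_steps_trans:
  "within_steps E M x y \<Longrightarrow> within_steps E N y z \<Longrightarrow> within_steps E (M + N) x z"
  unfolding within_steps_def by (metis add_mono relcompI relpow_add)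

lemma within_steps_mono: "within_steps E M x y \<Longrightarrow> M \<le> N \<Longrightarrow> within_steps E N x y"
  unfolding within_steps_def using order_trans by blast

lemma within_steps_sym:
  assumes "sym E" and "within_steps E N x y"
  shows "within_steps E N y x"
proof -
  have "(E ^^ r)\<inverse> = E ^^ r" for r
    using assms(1) by (induction r) (auto simp: relpow_commute converse_relcomp sym_conv_converse_eq)
  then show ?thesis
    using assms(2) unfolding within_steps_def by (metis converse_iff)
qed

lemma (in pair_graph) within_steps_awalk:
  assumes "within_steps (parcs G) N u v" and "u \<in> pverts G"
  obtains p where "awalk u p v" and "length p \<le> N"
proof -
  obtain r where r: "r \<le> N" "(u, v) \<in> parcs G ^^ r"
    using assms(1) by (auto simp: within_steps_def)
  have "\<exists>p. awalk u p v \<and> length p = r"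
    using r(2)
  proof (induction r arbitrary: v)
    case 0
    then show ?case using assms(2) by (auto simp: awalk_def)
  next
    case (Suc r)
    then obtain w where w: "(u, w) \<in> parcs G ^^ r" "(w, v) \<in> parcs G" by auto
    then obtain p where p: "awalk u p w" "length p = r" using Suc by blast
    have "awalk w [(w, v)] v" using w(2) arc_implies_awalk[of "(w, v)"] by simp
    then have "awalk u (p @ [(w, v)]) v" using p(1) by (rule awalk_appendI[rotated])
    then show ?case using p(2) by (intro exI[of _ "p @ [(w, v)]"]) auto
  qed
  then show ?thesis using that r(1) by auto
qed

lemma (in pair_graph) graph_distance_within_steps:
  assumes "within_steps (parcs G) N u v" and "u \<in> pverts G"
  shows "graph_distance (with_proj G) u v \<le> ereal (real N)"
proof -
  obtain p where p: "awalk u p v" "length p \<le> N"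
    using within_steps_awalk[OF assms] .
  have "awalk_cost (\<lambda>_. 1) q = real (length q)" for q :: "('a \<times> 'a) list"
    by (induction q) auto
  then have "graph_distance (with_proj G) u v \<le> ereal (real (length p))"
    unfolding graph_distance_def using min_cost_le_walk_cost[OF p(1), of "\<lambda>_. 1"] by simp
  also have "\<dots> \<le> ereal (real N)" using p(2) by simp
  finally show ?thesis .
qed

lemma (in pair_graph) connected_diameter_within_steps:
  assumes "pverts G \<noteq> {}"
    and "\<And>u v. u \<in> pverts G \<Longrightarrow> v \<in> pverts G \<Longrightarrow> within_steps (parcs G) N u v"
  shows "Digraph_Component.connected (with_proj G)"
    and "graph_diameter (with_proj G) \<le> ereal (real N)"
proof -
  show "Digraph_Component.connected (with_proj G)"
    unfolding Digraph_Component.connected_def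
  proof (rule strongly_connectedI)
    show "verts (mk_symmetric (with_proj G)) \<noteq> {}"
      using assms(1) by simp
  next
    fix u v
    assume "u \<in> verts (mk_symmetric (with_proj G))" "v \<in> verts (mk_symmetric (with_proj G))"
    then have uv: "u \<in> pverts G" "v \<in> pverts G" by simp_all
    then obtain p where "awalk u p v"
      using within_steps_awalk[OF assms(2)] by metis
    \<comment> \<open>Connectedness means strong connectedness of the symmetric closure, to which
      reachability carries over.\<close>
    then have "u \<rightarrow>\<^sup>*\<^bsub>with_proj G\<^esub> v" unfolding reachable_awalk by blast
    then show "u \<rightarrow>\<^sup>*\<^bsub>mk_symmetric (with_proj G)\<^esub> v"
      by (rule reachable_mk_symmetricI)
  qed
  show "graph_diameter (with_proj G) \<le> ereal (real N)"
    unfolding graph_diameter_def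
    using graph_distance_within_steps[OF assms(2)] by (auto intro!: SUP_least)
qed

section \<open>Lower parts of finite sets\<close>

text \<open>By injectivity of \<open>g\<close>, counting the smaller elements is an injective map
  from \<open>A\<close> into \<open>{..<card A}\<close>, hence onto.\<close>

lemma ex_element_of_rank:
  fixes g :: "'a \<Rightarrow> 'b::linorder"
  assumes "finite A" "inj_on g A" "r < card A"
  shows "\<exists>x\<in>A. card {a \<in> A. g a < g x} = r"
proof -
  let ?h = "\<lambda>x. card {a \<in> A. g a < g x}"
  have less: "?h x < ?h y" if "x \<in> A" "g x < g y" for x y
    using assms(1) that by (intro psubset_card_mono) auto
  have "inj_on ?h A"
  proof (rule inj_onI)
    fix x y assume "x \<in> A" "y \<in> A" "?h x = ?h y"
    then have "g x = g y" using less[of x y] less[of y x] by (cases "g x" "g y" rule: linorder_cases) auto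
    then show "x = y" using \<open>x \<in> A\<close> \<open>y \<in> A\<close> assms(2) by (auto dest: inj_onD)
  qed
  then have "card (?h ` A) = card A" by (rule card_image)
  moreover have "?h x < card A" if "x \<in> A" for x
    using that assms(1) by (intro psubset_card_mono) auto
  then have "?h ` A \<subseteq> {..<card A}" by auto
  ultimately have "?h ` A = {..<card A}"
    by (metis card_lessThan card_subset_eq finite_lessThan)
  then show ?thesis using assms(3) by (metis (no_types, lifting) imageE lessThan_iff)
qed

lemma ex_lower_part_of_card:
  fixes g :: "'a \<Rightarrow> int"
  assumes "finite A" "inj_on g A" "r \<le> card A" "\<And>a. a \<in> A \<Longrightarrow> g a \<le> hi"
  shows "\<exists>c\<le>hi. card {a \<in> A. g a \<le> c} = r"
proof (cases r)
  case 0
  show ?thesis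
  proof (cases "A = {}")
    case True
    then show ?thesis using 0 by auto
  next
    case False
    let ?c = "Min (g ` A) - 1"
    have lt: "?c < g a" if "a \<in> A" for a
    proof -
      have "Min (g ` A) \<le> g a" using that assms(1) by simp
      then show ?thesis by linarith
    qed
    then have "{a \<in> A. g a \<le> ?c} = {}" by force
    moreover have "?c \<le> hi"
      using False lt assms(4) by fastforce
    ultimately show ?thesis using 0 by (metis card.empty)
  qed
next
  case (Suc r')
  then obtain x where x: "x \<in> A" "card {a \<in> A. g a < g x} = r'"
    using ex_element_of_rank[OF assms(1,2), of r'] assms(3) by auto
  have "{a \<in> A. g a \<le> g x} = insert x {a \<in> A. g a < g x}"
    using x(1) assms(2) by (auto simp: inj_on_def order_le_less)
  then have "card {a \<in> A. g a \<le> g x} = r"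
    using x assms(1) Suc by simp
  then show ?thesis using x(1) assms(4) by blast
qed

section \<open>Islands\<close>

text \<open>A combination with positive weights lies strictly below \<open>c\<close> unless both
  points have \<open>f = c\<close>, and then \<open>g\<close> decides. Such sets serve to delete
  just one of two points on a supporting line.\<close>

lemma convex_lexicographic_halfspace:
  fixes f g :: "'a::real_vector \<Rightarrow> real"
  assumes "linear f" "linear g"
  shows "convex {z. f z < c \<or> (f z = c \<and> g z < d)}"
proof (rule convexI)
  fix x y u v
  assume xy: "x \<in> {z. f z < c \<or> (f z = c \<and> g z < d)}" "y \<in> {z. f z < c \<or> (f z = c \<and> g z < d)}"
    and uv: "0 \<le> u" "0 \<le> v" "u + v = (1::real)"
  have f: "f (u *\<^sub>R x + v *\<^sub>R y) = u * f x + v * f y"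
    and g: "g (u *\<^sub>R x + v *\<^sub>R y) = u * g x + v * g y"
    using assms by (simp_all add: linear_add linear_scale)
  show "u *\<^sub>R x + v *\<^sub>R y \<in> {z. f z < c \<or> (f z = c \<and> g z < d)}"
  proof (cases "u = 0 \<or> v = 0")
    case True
    then show ?thesis using xy uv by auto
  next
    case False
    then have pos: "u > 0" "v > 0" using uv by auto
    have le: "f x \<le> c" "f y \<le> c" using xy by auto
    have cc: "u * c + v * c = c" "u * d + v * d = d" using uv by (simp_all add: distrib_right[symmetric])
    consider "f x < c" | "f y < c" | "f x = c" "f y = c" "g x < d" "g y < d"
      using xy by force
    then show ?thesis
    proof cases
      case 1
      then have "u * f x < u * c" "v * f y \<le> v * c" using pos le by auto
      then show ?thesis using f cc by simp
    next
      case 2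
      then have "u * f x \<le> u * c" "v * f y < v * c" using pos le by auto
      then show ?thesis using f cc by simp
    next
      case 3
      then have "u * g x < u * d" "v * g y < v * d" using pos by auto
      then show ?thesis using f g cc 3 by simp
    qed
  qed
qed

lemma convex_linear_less: "linear f \<Longrightarrow> convex {z. f z < (c::real)}"
  using convex_lexicographic_halfspace[of f "\<lambda>_. 0" c 0] by (simp add: linear_zero)

lemma islandI: "convex C \<Longrightarrow> I = P \<inter> C \<Longrightarrow> island P I"
  by (auto simp: island_def)

lemma island_Int: "island P I \<Longrightarrow> convex C \<Longrightarrow> island P (I \<inter> C)"
  unfolding island_def by (metis convex_Int inf_assoc)

lemma island_imp_subset: "island P I \<Longrightarrow> I \<subseteq> P"
  by (auto simp: island_def)

lemma island_eq_Int_hull: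
  assumes "island P I"
  shows "I = P \<inter> convex hull I"
proof -
  obtain C where C: "convex C" "I = P \<inter> C" using assms by (auto simp: island_def)
  have "convex hull I \<subseteq> C" using C by (intro hull_minimal) auto
  then show ?thesis using C(2) hull_subset[of I convex] by auto
qed

text \<open>Islands form a convex geometry: one can pass from a larger island to a smaller one by deleting
  one extreme point at a time.\<close>

lemma island_remove_extreme_point:
  assumes "finite P" "island P G" "island P Q" "G \<subset> Q"
  shows "\<exists>v\<in>Q - G. island P (Q - {v})"
proof -
  have fin: "finite Q" using assms(1,3) finite_subset island_imp_subset by blast
  \<comment> \<open>Otherwise, by Krein-Milman, the hull of \<open>Q\<close> would lie in the hull
    of \<open>G\<close>.\<close>
  have "\<exists>v. v extreme_point_of (convex hull Q) \<and> v \<notin> G"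
  proof (rule ccontr)
    assume "\<not> ?thesis"
    then have "convex hull {x. x extreme_point_of (convex hull Q)} \<subseteq> convex hull G"
      by (intro hull_mono) auto
    then have "Q \<subseteq> convex hull G"
      using Krein_Milman_polytope[OF fin] hull_subset[of Q convex] by auto
    then have "Q \<subseteq> G"
      using island_eq_Int_hull[OF assms(2)] island_imp_subset[OF assms(3)] by blast
    then show False using assms(4) by auto
  qed
  then obtain v where v: "v extreme_point_of (convex hull Q)" "v \<notin> G" by auto
  have "v \<in> Q" using v(1) extreme_point_of_convex_hull by blast
  moreover have "convex (convex hull Q - {v})"
    using v(1) extreme_point_of_stillconvex[OF convex_convex_hull] by blast
  then have "island P (Q - {v})"
    using island_eq_Int_hull[OF assms(3)] by (intro islandI) auto
  ultimately show ?thesis using v(2) by auto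
qed

text \<open>This is how a truncated island grows back: points are deleted from a large island around
  it until \<open>k\<close> remain.\<close>

lemma ex_island_between:
  assumes "finite P" "island P G" "island P Q" "G \<subseteq> Q" "card G \<le> k" "k \<le> card Q"
  shows "\<exists>I. island P I \<and> G \<subseteq> I \<and> I \<subseteq> Q \<and> card I = k"
  using assms(3,4,6)
proof (induction "card Q" arbitrary: Q)
  case 0
  then show ?case using assms(5) by (intro exI[of _ Q]) auto
next
  case (Suc x)
  have fin: "finite Q" using assms(1) Suc.prems(1) finite_subset island_imp_subset by blast
  show ?case
  proof (cases "card Q = k")
    case True
    then show ?thesis using Suc.prems by blast
  next
    case False
    then have "G \<noteq> Q" using assms(5) Suc.prems by auto
    then obtain v where v: "v \<in> Q - G" "island P (Q - {v})"
      using island_remove_extreme_point[OF assms(1,2) Suc.prems(1)] Suc.prems(2) by auto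
    have c: "card (Q - {v}) = card Q - 1" using v fin by simp
    show ?thesis
      using Suc.hyps(1)[of "Q - {v}"] Suc.hyps(2) v Suc.prems False c by fastforce
  qed
qed

text \<open>The maximal height at which a segment from \<open>A\<close> to \<open>B\<close> crosses a vertical line separating
  the two sets is attained on a common supporting line.\<close>

lemma ex_upper_bridge:
  fixes X Y :: "'a \<Rightarrow> real"
  assumes fin: "finite A" "finite B" and ne: "A \<noteq> {}" "B \<noteq> {}"
    and sep: "\<And>a b. a \<in> A \<Longrightarrow> b \<in> B \<Longrightarrow> X a < X b"
  shows "\<exists>s\<in>A. \<exists>t\<in>B. \<exists>\<alpha> \<beta>. Y s = \<alpha> * X s + \<beta> \<and> Y t = \<alpha> * X t + \<beta> \<and>
    (\<forall>u\<in>A \<union> B. Y u \<le> \<alpha> * X u + \<beta>)"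
proof -
  have "Max (X ` A) < Min (X ` B)"
    using fin ne sep by (simp add: Max_less_iff)
  then obtain c where c: "Max (X ` A) < c" "c < Min (X ` B)"
    using dense by blast
  have Ac: "X a < c" if "a \<in> A" for a
    using that c(1) fin ne by (simp add: Max_less_iff)
  have cB: "c < X b" if "b \<in> B" for b
    using that c(2) fin ne by simp
  \<comment> \<open>\<open>h a b\<close> is the height at which the line through \<open>a\<close>
    and \<open>b\<close> crosses the vertical line at \<open>c\<close>.\<close>
  define h where "h a b = ((X b - c) * Y a + (c - X a) * Y b) / (X b - X a)" for a b
  define H where "H = (\<lambda>p. h (fst p) (snd p)) ` (A \<times> B)"
  have finH: "finite H" "H \<noteq> {}" using fin ne by (auto simp: H_def)
  obtain s t where st: "s \<in> A" "t \<in> B" "Max H = h s t"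
    using Max_in[OF finH] by (auto simp: H_def)
  have max: "h a b \<le> h s t" if "a \<in> A" "b \<in> B" for a b
    unfolding st(3)[symmetric] using that finH by (intro Max_ge) (force simp: H_def)+
  define \<alpha> where "\<alpha> = (Y t - Y s) / (X t - X s)"
  define \<beta> where "\<beta> = Y s - \<alpha> * X s"
  have "X t - X s \<noteq> 0" using sep[OF st(1,2)] by simp
  then have "\<alpha> * (X t - X s) = Y t - Y s" by (simp add: \<alpha>_def)
  then have Ys: "Y s = \<alpha> * X s + \<beta>" and Yt: "Y t = \<alpha> * X t + \<beta>"
    by (simp_all add: \<beta>_def algebra_simps)
  have interp: "(y - c) * (\<alpha> * x + \<beta>) + (c - x) * (\<alpha> * y + \<beta>) = (\<alpha> * c + \<beta>) * (y - x)" for x y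
    by (simp add: algebra_simps)
  have "h s t = \<alpha> * c + \<beta>"
    using interp[of "X t" "X s"] \<open>X t - X s \<noteq> 0\<close> by (simp add: h_def Ys Yt)
  then have le: "(X b - c) * Y a + (c - X a) * Y b \<le> (\<alpha> * c + \<beta>) * (X b - X a)"
    if "a \<in> A" "b \<in> B" for a b
    using max[OF that] sep[OF that] by (simp add: h_def divide_le_eq)
  \<comment> \<open>The maximal pair is compared with the pair in which \<open>u\<close> replaces
    the point on its own side. The other point lies on the line, so its terms cancel.\<close>
  have "Y u \<le> \<alpha> * X u + \<beta>" if u: "u \<in> A \<union> B" for u
  proof (cases "u \<in> A")
    case True
    have "(X t - c) * Y u \<le> (X t - c) * (\<alpha> * X u + \<beta>)"
      using le[OF True st(2)] interp[of "X t" "X u"] by (simp add: Yt)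
    then show ?thesis using cB[OF st(2)] by simp
  next
    case False
    then have uB: "u \<in> B" using u by simp
    have "(c - X s) * Y u \<le> (c - X s) * (\<alpha> * X u + \<beta>)"
      using le[OF st(1) uB] interp[of "X u" "X s"] by (simp add: Ys)
    then show ?thesis using Ac[OF st(1)] by simp
  qed
  then show ?thesis using st Ys Yt by blast
qed

text \<open>\<open>J\<close> omits \<open>s\<close> and \<open>t\<close>, keeps the last
  \<open>k - m\<close> other points of \<open>S\<close> in the order of \<open>g\<close> and adds
  the first \<open>m\<close> points beyond \<open>S\<close> with \<open>f < c\<close>. An
  integer-valued \<open>g\<close> can be the rank or the negated rank, which covers both
  directions.\<close>

lemma ex_common_neighbour:
  fixes f :: "real^2 \<Rightarrow> real" and g :: "real^2 \<Rightarrow> int"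
  assumes fin: "finite P" and inj: "inj_on g P" and conv: "\<And>a b. convex {z. a \<le> g z \<and> g z \<le> b}"
    and S: "S = {p \<in> P. lo \<le> g p \<and> g p \<le> hi}" "card S = Suc k"
    and st: "s \<in> S" "t \<in> S" "s \<noteq> t"
    and f: "linear f" "f s = c" "f t = c" "\<And>p. p \<in> S \<Longrightarrow> p \<noteq> s \<Longrightarrow> p \<noteq> t \<Longrightarrow> f p < c"
    and m: "m \<le> card {p \<in> P. hi < g p \<and> f p < c}" "0 < m" "m \<le> k"
  shows "\<exists>J. island P J \<and> card J = k \<and> card (J \<inter> (S - {s})) = k - m \<and> card (J \<inter> (S - {t})) = k - m"
proof -
  define A where "A = S - {s, t}"
  define B where "B = {p \<in> P. hi < g p \<and> f p < c}"
  have finS: "finite S" and SP: "S \<subseteq> P" using S(1) fin by auto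
  have finA: "finite A" and finB: "finite B" and subs: "A \<subseteq> P" "B \<subseteq> P"
    using finS fin SP by (auto simp: A_def B_def)
  have "S - {s, t} = S - {s} - {t}" by auto
  then have cardA: "card A = k - 1"
    using S(2) st finS by (simp add: A_def)
  \<comment> \<open>Dropping the first \<open>m - 1\<close> of the \<open>k - 1\<close> points of
    \<open>A\<close> leaves \<open>k - m\<close>.\<close>
  have "\<exists>c1\<le>hi. card {a \<in> A. g a \<le> c1} = m - 1"
    using finA cardA m S(1) inj_on_subset[OF inj subs(1)]
    by (intro ex_lower_part_of_card) (auto simp: A_def)
  then obtain c1 where c1: "c1 \<le> hi" "card {a \<in> A. g a \<le> c1} = m - 1" by auto
  have "\<exists>c2\<le>Max (g ` P). card {b \<in> B. g b \<le> c2} = m"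
    using finB m(1) fin subs(2) inj_on_subset[OF inj subs(2)]
    by (intro ex_lower_part_of_card) (auto simp: B_def)
  then obtain c2 where c2: "card {b \<in> B. g b \<le> c2} = m" by auto
  then have "{b \<in> B. g b \<le> c2} \<noteq> {}" using m(2) by (metis card.empty less_irrefl)
  then obtain b where "b \<in> B" "g b \<le> c2" by auto
  then have c2hi: "hi < c2" by (auto simp: B_def)
  \<comment> \<open>Nothing bounds \<open>c1\<close> from below, so \<open>lo\<close> keeps out the
    points before \<open>S\<close>.\<close>
  define C where "C = {z. max lo (c1 + 1) \<le> g z \<and> g z \<le> c2} \<inter> {z. f z < c}"
  define J where "J = P \<inter> C"
  have "convex C" unfolding C_def by (intro convex_Int conv convex_linear_less f(1))
  then have isl: "island P J" by (rule islandI) (simp add: J_def)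
  have JA: "J \<inter> S = {a \<in> A. c1 < g a}"
    unfolding J_def C_def A_def using f(2-4) S(1) c2hi by auto
  have JB: "J - S = {b \<in> B. g b \<le> c2}"
    unfolding J_def C_def B_def using S(1) c1 c2hi st(1) by auto
  have "{a \<in> A. c1 < g a} = A - {a \<in> A. g a \<le> c1}" by auto
  then have "card (J \<inter> S) = (k - 1) - (m - 1)"
    unfolding JA using finA c1 cardA by (simp add: card_Diff_subset)
  then have cJS: "card (J \<inter> S) = k - m" using m by simp
  have "finite J" using fin by (simp add: J_def)
  then have "card J = card (J \<inter> S) + card (J - S)"
    by (simp add: card_Diff_subset_Int[of J S] Int_commute card_mono)
  then have "card J = k" using JB c2 cJS m by simp
  moreover have "J \<inter> (S - {s}) = J \<inter> S" "J \<inter> (S - {t}) = J \<inter> S"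
    using JA by (auto simp: A_def)
  ultimately show ?thesis using isl cJS by auto
qed

section \<open>Ranks along a generic direction\<close>

text \<open>Lines are written as graphs over \<open>X\<close>. On a line where \<open>X\<close> is
  constant, \<open>inj_X\<close> allows at most one point of \<open>P\<close>.\<close>

locale ranked_points =
  fixes P :: "(real^2) set" and X Y :: "real^2 \<Rightarrow> real"
  assumes finite_points: "finite P"
    and linear_X: "linear X" and linear_Y: "linear Y"
    and inj_X: "inj_on X P"
    and not_on_line: "\<lbrakk>a \<in> P; b \<in> P; c \<in> P; a \<noteq> b; a \<noteq> c; b \<noteq> c;
      Y a = \<alpha> * X a + \<beta>; Y b = \<alpha> * X b + \<beta>\<rbrakk> \<Longrightarrow> Y c \<noteq> \<alpha> * X c + \<beta>"
begin

text \<open>The rank is defined on the whole plane, so that rank conditions describe convex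
  sets.\<close>

definition rk :: "real^2 \<Rightarrow> nat" where
  "rk z = card {q \<in> P. X q < X z}"

lemma rk_mono: "X z \<le> X w \<Longrightarrow> rk z \<le> rk w"
  unfolding rk_def using finite_points by (intro card_mono) auto

lemma rk_less: "p \<in> P \<Longrightarrow> X p < X w \<Longrightarrow> rk p < rk w"
  unfolding rk_def using finite_points by (intro psubset_card_mono) auto

lemma X_less_of_rk_less: "rk z < rk w \<Longrightarrow> X z < X w"
  using rk_mono[of w z] by linarith

lemma inj_rk: "inj_on rk P"
proof (rule inj_onI)
  fix p q assume pq: "p \<in> P" "q \<in> P" "rk p = rk q"
  then have "X p = X q"
    using rk_less[of p q] rk_less[of q p] by linarith
  then show "p = q" using pq inj_X by (auto dest: inj_onD)
qed

lemma ex_rk: "r < card P \<Longrightarrow> \<exists>p\<in>P. rk p = r"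
  using ex_element_of_rank[OF finite_points inj_X] by (simp add: rk_def)

lemma rk_less_card: "p \<in> P \<Longrightarrow> rk p < card P"
  unfolding rk_def using finite_points by (intro psubset_card_mono) auto

text \<open>\<open>rk\<close> is a monotone function of \<open>X\<close>, and the value of
  \<open>X\<close> at a convex combination lies between those at the two points.\<close>

lemma convex_rk_slab: "convex {z. a \<le> rk z \<and> rk z \<le> b}"
proof (rule convexI)
  fix x y :: "real^2" and u v :: real
  assume xy: "x \<in> {z. a \<le> rk z \<and> rk z \<le> b}" "y \<in> {z. a \<le> rk z \<and> rk z \<le> b}"
    and uv: "0 \<le> u" "0 \<le> v" "u + v = 1"
  let ?z = "u *\<^sub>R x + v *\<^sub>R y"
  have z: "X ?z = u * X x + v * X y"
    using linear_X by (simp add: linear_add linear_scale)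
  have "min (X x) (X y) \<le> X ?z" "X ?z \<le> max (X x) (X y)"
    using convex_bound_le[of "- X x" "- min (X x) (X y)" "- X y" u v]
      convex_bound_le[of "X x" "max (X x) (X y)" "X y" u v] uv z by simp_all
  then have "X x \<le> X ?z \<or> X y \<le> X ?z" "X ?z \<le> X x \<or> X ?z \<le> X y"
    by (auto simp: min_def max_def split: if_splits)
  then have "rk x \<le> rk ?z \<or> rk y \<le> rk ?z" "rk ?z \<le> rk x \<or> rk ?z \<le> rk y"
    using rk_mono by blast+
  then show "?z \<in> {z. a \<le> rk z \<and> rk z \<le> b}"
    using xy by auto
qed

definition slab :: "nat \<Rightarrow> nat \<Rightarrow> (real^2) set" where
  "slab a b = {p \<in> P. a \<le> rk p \<and> rk p < b}"

lemma slab_subset: "slab a b \<subseteq> P"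
  by (auto simp: slab_def)

lemma finite_slab: "finite (slab a b)"
  using finite_subset[OF slab_subset finite_points] .

lemma slab_Int: "slab a b \<inter> slab c d = slab (max a c) (min b d)"
  by (auto simp: slab_def)

lemma card_slab: "b \<le> card P \<Longrightarrow> card (slab a b) = b - a"
proof -
  assume b: "b \<le> card P"
  have "rk ` slab a b = {a..<b}"
  proof
    show "{a..<b} \<subseteq> rk ` slab a b"
    proof
      fix r assume "r \<in> {a..<b}"
      moreover then obtain p where "p \<in> P" "rk p = r" using ex_rk[of r] b by auto
      ultimately show "r \<in> rk ` slab a b" by (auto simp: slab_def)
    qed
  qed (auto simp: slab_def)
  then show ?thesis
    using card_image[OF inj_on_subset[OF inj_rk slab_subset]] by (metis card_atLeastLessThan)
qed

lemma island_slab: "island P (slab a b)"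
proof (cases b)
  case 0
  then show ?thesis by (intro islandI[of "{}"]) (auto simp: slab_def)
next
  case (Suc b')
  then show ?thesis
    by (intro islandI[OF convex_rk_slab[of a b']]) (auto simp: slab_def)
qed

text \<open>The line through \<open>u\<close> and \<open>w\<close> supports the slab. The open
  half-plane and the ray of the line on the side of \<open>w\<close> together contain all its points
  but \<open>u\<close>.\<close>

lemma island_slab_diff:
  fixes f :: "real^2 \<Rightarrow> real"
  assumes f: "linear f" and u: "u \<in> slab a b" "w \<in> slab a b" "u \<noteq> w"
    and fc: "f u = c" "f w = c"
    and less: "\<And>p. p \<in> slab a b \<Longrightarrow> p \<noteq> u \<Longrightarrow> p \<noteq> w \<Longrightarrow> f p < c"
  shows "island P (slab a b - {u})"
proof -
  have ne: "X u \<noteq> X w" using u inj_X slab_subset by (auto dest: inj_onD)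
  \<comment> \<open>The sign is chosen such that \<open>g w < g u\<close>.\<close>
  define g where "g z = (if X u < X w then - X z else X z)" for z
  have "linear g"
    unfolding g_def using linear_X linear_compose_neg[OF linear_X] by (cases "X u < X w") simp_all
  then have "convex {z. f z < c \<or> (f z = c \<and> g z < g u)}"
    using f by (intro convex_lexicographic_halfspace)
  then have "island P (slab a b \<inter> {z. f z < c \<or> (f z = c \<and> g z < g u)})"
    by (intro island_Int island_slab)
  also have "slab a b \<inter> {z. f z < c \<or> (f z = c \<and> g z < g u)} = slab a b - {u}"
  proof -
    have "g w < g u" using ne by (simp add: g_def)
    then have "f p < c \<or> (f p = c \<and> g p < g u)" if "p \<in> slab a b" "p \<noteq> u" for p
      using less[OF that] fc(2) by blast
    then show ?thesis using fc(1) by auto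
  qed
  finally show ?thesis .
qed

end

section \<open>Windows of consecutive ranks\<close>

text \<open>\<open>m\<close> stands for \<open>k - l\<close>, so \<open>l\<close> reads
  \<open>k - m\<close>.\<close>

locale ranked_island_graph = ranked_points +
  fixes k m :: nat
  assumes m_pos: "0 < m" and m_le: "m \<le> k" and room: "m * (m + 1) + k < card P"
begin

definition E :: "((real^2) set \<times> (real^2) set) set" where
  "E = {(I, J). I \<in> k_islands P k \<and> J \<in> k_islands P k \<and> card (I \<inter> J) = k - m}"

abbreviation near :: "nat \<Rightarrow> (real^2) set \<Rightarrow> (real^2) set \<Rightarrow> bool" where
  "near \<equiv> within_steps E"

abbreviation window :: "nat \<Rightarrow> (real^2) set" where
  "window j \<equiv> slab j (j + k)"

lemma sym_E: "sym E"
  by (auto simp: E_def sym_def Int_commute)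

lemma near_sym: "near N I J \<Longrightarrow> near N J I"
  by (rule within_steps_sym[OF sym_E])

lemma near_arc: "I \<in> k_islands P k \<Longrightarrow> J \<in> k_islands P k \<Longrightarrow> card (I \<inter> J) = k - m \<Longrightarrow> near 1 I J"
  by (rule within_steps_arc) (simp add: E_def)

lemma window_island: "j + k \<le> card P \<Longrightarrow> window j \<in> k_islands P k"
  by (simp add: k_islands_def island_slab card_slab)

lemma near_shift: "j + m + k \<le> card P \<Longrightarrow> near 1 (window j) (window (j + m))"
  by (intro near_arc window_island) (simp_all add: slab_Int card_slab)

lemma near_shifts: "j + d * m + k \<le> card P \<Longrightarrow> near d (window j) (window (j + d * m))"
proof (induction d)
  case 0
  then show ?case by (simp add: within_steps_refl)
next
  case (Suc d)
  have "near (d + 1) (window j) (window (j + d * m + m))"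
    by (rule within_steps_trans[OF Suc.IH near_shift]) (use Suc.prems in auto)
  then show ?case by (simp add: add_ac)
qed

section \<open>Moving a window by one position\<close>

lemma near_common_neighbour:
  fixes f :: "real^2 \<Rightarrow> real"
  assumes S: "S = slab j (Suc (j + k))" "j + k < card P"
    and st: "s \<in> S" "t \<in> S" "s \<noteq> t"
    and f: "linear f" "f s = c" "f t = c" "\<And>p. p \<in> S \<Longrightarrow> p \<noteq> s \<Longrightarrow> p \<noteq> t \<Longrightarrow> f p < c"
    and many: "m \<le> card {p \<in> P. j + k < rk p \<and> f p < c} \<or> m \<le> card {p \<in> P. rk p < j \<and> f p < c}"
  shows "near 2 (S - {s}) (S - {t})"
proof -
  have cardS: "card S = Suc k" using S by (simp add: card_slab)
  have "\<exists>J. island P J \<and> card J = k \<and> card (J \<inter> (S - {s})) = k - m \<and> card (J \<inter> (S - {t})) = k - m"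
    using many
  proof
    assume m: "m \<le> card {p \<in> P. j + k < rk p \<and> f p < c}"
    let ?g = "\<lambda>z. int (rk z)"
    have conv: "convex {z. a \<le> ?g z \<and> ?g z \<le> b}" for a b
    proof (cases "0 \<le> b")
      case True
      then have "{z. a \<le> ?g z \<and> ?g z \<le> b} = {z. nat a \<le> rk z \<and> rk z \<le> nat b}" by auto
      then show ?thesis by (simp add: convex_rk_slab)
    next
      case False
      then have "{z. a \<le> ?g z \<and> ?g z \<le> b} = {}" by auto
      then show ?thesis by (simp only: convex_empty)
    qed
    show ?thesis
    proof (rule ex_common_neighbour[where g = ?g and lo = "int j" and hi = "int (j + k)"])
      show "inj_on ?g P" using inj_rk by (auto simp: inj_on_def)
      show "S = {p \<in> P. int j \<le> ?g p \<and> ?g p \<le> int (j + k)}" by (auto simp: S(1) slab_def)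
      show "m \<le> card {p \<in> P. int (j + k) < ?g p \<and> f p < c}" using m by (simp only: of_nat_less_iff)
    qed (use finite_points conv cardS st f m_pos m_le in auto)
  next
    assume m: "m \<le> card {p \<in> P. rk p < j \<and> f p < c}"
    \<comment> \<open>Negating the rank turns the points to the left of \<open>S\<close> into points
      beyond it.\<close>
    let ?g = "\<lambda>z. - int (rk z)"
    have conv: "convex {z. a \<le> ?g z \<and> ?g z \<le> b}" for a b
    proof (cases "a \<le> 0")
      case True
      then have "{z. a \<le> ?g z \<and> ?g z \<le> b} = {z. nat (- b) \<le> rk z \<and> rk z \<le> nat (- a)}" by auto
      then show ?thesis by (simp add: convex_rk_slab)
    next
      case False
      then have "{z. a \<le> ?g z \<and> ?g z \<le> b} = {}" by auto
      then show ?thesis by (simp only: convex_empty)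
    qed
    show ?thesis
    proof (rule ex_common_neighbour[where g = ?g and lo = "- int (j + k)" and hi = "- int j"])
      show "inj_on ?g P" using inj_rk by (auto simp: inj_on_def)
      show "S = {p \<in> P. - int (j + k) \<le> ?g p \<and> ?g p \<le> - int j}" by (auto simp: S(1) slab_def)
      show "m \<le> card {p \<in> P. - int j < ?g p \<and> f p < c}"
        using m by (simp only: neg_less_iff_less of_nat_less_iff)
    qed (use finite_points conv cardS st f m_pos m_le in auto)
  qed
  then obtain J where J: "island P J" "card J = k"
    "card (J \<inter> (S - {s})) = k - m" "card (J \<inter> (S - {t})) = k - m" by auto
  have JK: "J \<in> k_islands P k" using J by (simp add: k_islands_def)
  have "island P (S - {s})"
    unfolding S(1) by (rule island_slab_diff[of f s _ _ t c]) (use S st f in auto)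
  then have s: "S - {s} \<in> k_islands P k"
    using cardS st by (simp add: k_islands_def)
  have "island P (S - {t})"
    unfolding S(1) by (rule island_slab_diff[of f t _ _ s c]) (use S st f in auto)
  then have t: "S - {t} \<in> k_islands P k"
    using cardS st by (simp add: k_islands_def)
  have "near (1 + 1) (S - {s}) (S - {t})"
    by (rule within_steps_trans[OF near_arc[OF s JK] near_arc[OF JK t]])
      (use J in \<open>auto simp: Int_commute\<close>)
  then show ?thesis by (simp add: numeral_2_eq_2)
qed

text \<open>Both windows at distance one arise from the slab of \<open>k + 1\<close> points by deleting an end point.
  Deleting \<open>t\<close> instead of the right end point is invisible to \<open>window (j + m)\<close>, which contains both;
  deleting \<open>s\<close> instead of the left end point is invisible to \<open>window (j + m + 1)\<close>, which contains
  neither.\<close>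

lemma near_window_Suc_via:
  fixes f :: "real^2 \<Rightarrow> real"
  assumes S: "S = slab j (Suc (j + k))" "Suc (j + m + k) \<le> card P"
    and st: "s \<in> S" "t \<in> S" "rk s < j + m" "j + m \<le> rk t"
    and f: "linear f" "f s = c" "f t = c" "\<And>p. p \<in> S \<Longrightarrow> p \<noteq> s \<Longrightarrow> p \<noteq> t \<Longrightarrow> f p < c"
    and many: "m \<le> card {p \<in> P. j + k < rk p \<and> f p < c} \<or> m \<le> card {p \<in> P. rk p < j \<and> f p < c}"
  shows "near 6 (window j) (window (Suc j))"
proof -
  have ne: "s \<noteq> t" using st by auto
  have cardS: "card S = Suc k" using S by (simp add: card_slab)
  have "island P (S - {s})"
    unfolding S(1) by (rule island_slab_diff[of f s _ _ t c]) (use S st f ne in auto)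
  then have s: "S - {s} \<in> k_islands P k"
    using cardS st by (simp add: k_islands_def)
  have "island P (S - {t})"
    unfolding S(1) by (rule island_slab_diff[of f t _ _ s c]) (use S st f ne in auto)
  then have t: "S - {t} \<in> k_islands P k"
    using cardS st by (simp add: k_islands_def)
  have "window (j + m) \<inter> (S - {t}) = slab (j + m) (Suc (j + k)) - {t}"
    using S(1) m_pos by (auto simp: slab_def)
  moreover have "t \<in> slab (j + m) (Suc (j + k))" using st S(1) by (auto simp: slab_def)
  ultimately have "card (window (j + m) \<inter> (S - {t})) = k - m"
    using S(2) m_le by (simp add: card_slab)
  then have 1: "near 1 (window (j + m)) (S - {t})"
    using S(2) t by (intro near_arc window_island) auto
  have "(S - {s}) \<inter> window (Suc (j + m)) = slab (Suc (j + m)) (Suc (j + k))"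
    using S(1) st(3) by (auto simp: slab_def)
  then have "card ((S - {s}) \<inter> window (Suc (j + m))) = k - m"
    using S(2) m_le by (simp add: card_slab)
  then have 2: "near 1 (S - {s}) (window (Suc (j + m)))"
    using S(2) s by (intro near_arc window_island) auto
  have 3: "near 1 (window j) (window (j + m))" using S(2) by (intro near_shift) simp
  have 4: "near 1 (window (Suc (j + m))) (window (Suc j))"
    using near_sym[OF near_shift[of "Suc j"]] S(2) by simp
  have 5: "near 2 (S - {t}) (S - {s})"
    using near_common_neighbour[OF S(1) _ st(1,2) ne f many] S(2) by (simp add: near_sym)
  \<comment> \<open>The walk is \<open>window j\<close>, \<open>window (j + m)\<close>,
    \<open>S - {t}\<close>, \<open>S - {s}\<close>, \<open>window (Suc (j + m))\<close>,
    \<open>window (Suc j)\<close>. Its middle link takes two steps, through the common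
    neighbour.\<close>
  have "near (1 + (1 + (2 + (1 + 1)))) (window j) (window (Suc j))"
    by (rule within_steps_trans[OF 3 within_steps_trans[OF 1 within_steps_trans[OF 5
      within_steps_trans[OF 2 4]]]])
  then show ?thesis by simp
qed

text \<open>The upper and the lower bridge of the slab do not cross on one of its two sides. There every
  outer point lies below the upper or above the lower line, so one of the two lines has at
  least \<open>m\<close> outer points on the side of the slab.\<close>

lemma near_window_Suc:
  assumes left: "2 * m \<le> Suc j" and right: "j + k + 2 * m \<le> card P"
  shows "near 6 (window j) (window (Suc j))"
proof -
  define S where "S = slab j (Suc (j + k))"
  define A where "A = slab j (j + m)"
  define B where "B = slab (j + m) (Suc (j + k))"
  have AB: "A \<union> B = S" using m_le by (auto simp: A_def B_def S_def slab_def)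
  have SP: "S \<subseteq> P" by (simp add: S_def slab_subset)
  have card: "card A = m" "card B = Suc (k - m)"
    using right m_pos m_le by (simp_all add: A_def B_def card_slab)
  then have ne: "A \<noteq> {}" "B \<noteq> {}" using m_pos by auto
  have fin: "finite A" "finite B" by (simp_all add: A_def B_def finite_slab)
  have sep: "X a < X b" if "a \<in> A" "b \<in> B" for a b
    using that by (intro X_less_of_rk_less) (auto simp: A_def B_def slab_def)
  obtain s t \<alpha> \<beta> where st: "s \<in> A" "t \<in> B" "Y s = \<alpha> * X s + \<beta>" "Y t = \<alpha> * X t + \<beta>"
    and up: "\<And>u. u \<in> S \<Longrightarrow> Y u \<le> \<alpha> * X u + \<beta>"
    using ex_upper_bridge[of A B X Y, OF fin ne sep] AB by blast
  obtain s' t' \<alpha>' \<beta>' where st': "s' \<in> A" "t' \<in> B"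
      "- Y s' = \<alpha>' * X s' + \<beta>'" "- Y t' = \<alpha>' * X t' + \<beta>'"
    and lo: "\<And>u. u \<in> S \<Longrightarrow> - Y u \<le> \<alpha>' * X u + \<beta>'"
    using ex_upper_bridge[of A B X "\<lambda>z. - Y z", OF fin ne sep] AB by blast
  define f where "f z = Y z - \<alpha> * X z" for z
  \<comment> \<open>The lower bridge is an upper bridge for \<open>- Y\<close>, so \<open>S\<close>
    lies in \<open>f' \<le> \<beta>'\<close>.\<close>
  define f' where "f' z = - Y z - \<alpha>' * X z" for z
  have lin: "linear f" "linear f'"
    unfolding f_def f'_def
    by (intro linear_compose_sub linear_compose_neg linear_Y
      linear_compose_scale_right[OF linear_X, unfolded real_scaleR_def])+
  have neq: "s \<noteq> t" "s' \<noteq> t'" using sep[OF st(1,2)] sep[OF st'(1,2)] by auto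
  have inS: "s \<in> S" "t \<in> S" "s' \<in> S" "t' \<in> S" using st(1,2) st'(1,2) AB by auto
  then have inP: "s \<in> P" "t \<in> P" "s' \<in> P" "t' \<in> P" using SP by auto
  have off: "f p \<noteq> \<beta>" if "p \<in> P" "p \<noteq> s" "p \<noteq> t" for p
    using not_on_line[of s t p \<alpha> \<beta>] that inP neq st(3,4) by (auto simp: f_def)
  have off': "f' p \<noteq> \<beta>'" if "p \<in> P" "p \<noteq> s'" "p \<noteq> t'" for p
    using not_on_line[of s' t' p "- \<alpha>'" "- \<beta>'"] that inP neq st'(3,4)
    by (auto simp: f'_def)
  have f: "f s = \<beta>" "f t = \<beta>" "f p < \<beta>" if "p \<in> S" "p \<noteq> s" "p \<noteq> t" for p
    using st(3,4) up[of p] off[of p] that SP by (auto simp: f_def)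
  have f': "f' s' = \<beta>'" "f' t' = \<beta>'" "f' p < \<beta>'" if "p \<in> S" "p \<noteq> s'" "p \<noteq> t'" for p
    using st'(3,4) lo[of p] off'[of p] that SP by (auto simp: f'_def)
  \<comment> \<open>The expression assumed nonnegative is the gap in \<open>Y\<close> between the
    upper and the lower line. Where the lines have not crossed, no point is both above the upper and
    below the lower one.\<close>
  have cover: "f p < \<beta> \<or> f' p < \<beta>'"
    if "p \<in> P" "p \<notin> S" "0 \<le> (\<alpha> + \<alpha>') * X p + (\<beta> + \<beta>')" for p
  proof -
    have "p \<noteq> s" "p \<noteq> t" using that(2) inS by auto
    then have "f p \<noteq> \<beta>" using off that(1) by auto
    moreover have "f p + f' p \<le> \<beta> + \<beta>'" using that(3) by (simp add: f_def f'_def algebra_simps)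
    ultimately show ?thesis by linarith
  qed
  have D: "0 \<le> (\<alpha> + \<alpha>') * X u + (\<beta> + \<beta>')" if "u \<in> S" for u
    using up[OF that] lo[OF that] by (simp add: algebra_simps)
  let ?R = "{p \<in> P. j + k < rk p \<and> f p < \<beta>}" and ?R' = "{p \<in> P. j + k < rk p \<and> f' p < \<beta>'}"
  let ?L = "{p \<in> P. rk p < j \<and> f p < \<beta>}" and ?L' = "{p \<in> P. rk p < j \<and> f' p < \<beta>'}"
  have "m \<le> card ?R \<or> m \<le> card ?R' \<or> m \<le> card ?L \<or> m \<le> card ?L'"
  \<comment> \<open>The gap is affine in \<open>X\<close> and nonnegative on \<open>S\<close>. The
    sign of its slope tells on which side of \<open>S\<close> it stays nonnegative.\<close>
  proof (cases "0 \<le> \<alpha> + \<alpha>'")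
    case True
    have "slab (Suc (j + k)) (card P) \<subseteq> ?R \<union> ?R'"
    proof
      fix p assume "p \<in> slab (Suc (j + k)) (card P)"
      then have p: "p \<in> P" "j + k < rk p" by (auto simp: slab_def)
      then have "rk t < rk p" "p \<notin> S" using inS by (auto simp: S_def slab_def)
      then have "X t \<le> X p" using X_less_of_rk_less by force
      then have "0 \<le> (\<alpha> + \<alpha>') * X p + (\<beta> + \<beta>')"
        using D[OF inS(2)] mult_left_mono[OF _ True, of "X t" "X p"] by linarith
      then show "p \<in> ?R \<union> ?R'" using p cover[OF p(1) \<open>p \<notin> S\<close>] by auto
    qed
    then have "card (slab (Suc (j + k)) (card P)) \<le> card (?R \<union> ?R')"
      using finite_points by (intro card_mono) auto
    also have "\<dots> \<le> card ?R + card ?R'" by (rule card_Un_le)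
    \<comment> \<open>At least \<open>2 * m - 1\<close> points are covered by two sets, so one of
      these has at least \<open>m\<close>.\<close>
    finally show ?thesis using right m_pos by (simp add: card_slab) linarith
  next
    case False
    have "slab 0 j \<subseteq> ?L \<union> ?L'"
    proof
      fix p assume "p \<in> slab 0 j"
      then have p: "p \<in> P" "rk p < j" by (auto simp: slab_def)
      then have "rk p < rk s" "p \<notin> S" using inS by (auto simp: S_def slab_def)
      then have "X p \<le> X s" using X_less_of_rk_less by force
      then have "(\<alpha> + \<alpha>') * X s \<le> (\<alpha> + \<alpha>') * X p"
        using False by (intro mult_left_mono_neg) auto
      then have "0 \<le> (\<alpha> + \<alpha>') * X p + (\<beta> + \<beta>')"
        using D[OF inS(1)] by linarith
      then show "p \<in> ?L \<union> ?L'" using p cover[OF p(1) \<open>p \<notin> S\<close>] by auto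
    qed
    then have "card (slab 0 j) \<le> card (?L \<union> ?L')"
      using finite_points by (intro card_mono) auto
    also have "\<dots> \<le> card ?L + card ?L'" by (rule card_Un_le)
    finally show ?thesis using left right m_pos by (simp add: card_slab) linarith
  qed
  then consider "m \<le> card ?R \<or> m \<le> card ?L" | "m \<le> card ?R' \<or> m \<le> card ?L'" by blast
  then show ?thesis
  proof cases
    case 1
    show ?thesis
    proof (rule near_window_Suc_via[OF S_def _ inS(1,2) _ _ lin(1) _ _ _ 1])
      show "Suc (j + m + k) \<le> card P" using right m_pos by simp
      show "rk s < j + m" "j + m \<le> rk t" using st(1,2) by (auto simp: A_def B_def slab_def)
    qed (use st(3,4) f in \<open>auto simp: f_def\<close>)
  next
    case 2
    show ?thesis
    proof (rule near_window_Suc_via[OF S_def _ inS(3,4) _ _ lin(2) _ _ _ 2])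
      show "Suc (j + m + k) \<le> card P" using right m_pos by simp
      show "rk s' < j + m" "j + m \<le> rk t'" using st'(1,2) by (auto simp: A_def B_def slab_def)
    qed (use st'(3,4) f' in \<open>auto simp: f'_def\<close>)
  qed
qed

section \<open>Central windows, at the positions \<open>2 * m - 1\<close> to
  \<open>3 * m - 2\<close>\<close>

lemma room_linear: "5 * m + k \<le> card P + 3"
proof -
  have "5 * m \<le> m * (m + 1) + 4"
  proof -
    have "0 \<le> (int m - 2)\<^sup>2" by simp
    then have "int (5 * m) \<le> int (m * (m + 1) + 4)"
      by (simp add: power2_eq_square algebra_simps)
    then show ?thesis by (simp only: of_nat_le_iff)
  qed
  then show ?thesis using room by linarith
qed

lemma near_central_windows_le:
  assumes "a \<le> b" "2 * m \<le> Suc a" "b + 2 \<le> 3 * m"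
  shows "near (6 * (b - a)) (window a) (window b)"
  using assms(1,3)
proof (induction b rule: dec_induct)
  case base
  then show ?case by (simp add: within_steps_refl)
next
  case (step b)
  \<comment> \<open>The last possible move starts at \<open>b = 3 * m - 3\<close>, where the room
    needed on the right is exactly \<open>room_linear\<close>.\<close>
  have "near 6 (window b) (window (Suc b))"
    using step assms(2) room_linear by (intro near_window_Suc) auto
  then have "near (6 * (b - a) + 6) (window a) (window (Suc b))"
    by (rule within_steps_trans[rotated]) (use step in auto)
  then show ?case using step by (simp add: Suc_diff_le add.commute)
qed

lemma near_central_windows:
  assumes "2 * m \<le> Suc a" "a + 2 \<le> 3 * m" "2 * m \<le> Suc b" "b + 2 \<le> 3 * m"
  shows "near (6 * m) (window a) (window b)"
proof (cases a b rule: le_cases)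
  case le
  then show ?thesis
    using within_steps_mono[OF near_central_windows_le[of a b], of "6 * m"] assms by simp
next
  case ge
  then show ?thesis
    using within_steps_mono[OF near_sym[OF near_central_windows_le[of b a]], of "6 * m"] assms by simp
qed

text \<open>The central positions represent each residue modulo \<open>m\<close> exactly once, so
  shifts by \<open>m\<close> lead to one of them.\<close>

lemma near_central_window:
  assumes "j + k \<le> card P"
  shows "\<exists>w. 2 * m \<le> Suc w \<and> w + 2 \<le> 3 * m \<and> near (card P div m + 2) (window j) (window w)"
proof (cases "2 * m \<le> Suc j")
  case True
  define i where "i = Suc j - 2 * m"
  \<comment> \<open>This is the central position congruent to \<open>j\<close> modulo
    \<open>m\<close>.\<close>
  define w where "w = 2 * m - 1 + i mod m"
  define d where "d = i div m"
  have jw: "j = w + d * m"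
    using True m_pos by (simp add: w_def d_def i_def)
  have "near d (window w) (window j)"
    using near_shifts[of w d] assms jw by simp
  moreover have "d \<le> card P div m + 2"
    unfolding d_def by (rule le_trans[OF div_le_mono[of _ "card P"]]) (use assms m_pos in \<open>auto simp: i_def\<close>)
  ultimately have "near (card P div m + 2) (window j) (window w)"
    by (rule within_steps_mono[OF near_sym])
  moreover have "i mod m < m" using m_pos by simp
  then have "2 * m \<le> Suc w" "w + 2 \<le> 3 * m" using m_pos unfolding w_def by linarith+
  ultimately show ?thesis by blast
next
  case False
  \<comment> \<open>One shift suffices from position \<open>m - 1\<close> on; smaller positions need
    two.\<close>
  define d where "d = (if m \<le> Suc j then 1 else 2 :: nat)"
  have "d \<le> 2" "2 * m \<le> Suc (j + d * m)" "j + d * m + 2 \<le> 3 * m"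
    using False by (auto simp: d_def)
  moreover from this have "near (card P div m + 2) (window j) (window (j + d * m))"
    using within_steps_mono[OF near_shifts[of j d], of "card P div m + 2"] room_linear m_pos
    by simp
  ultimately show ?thesis by blast
qed

section \<open>From an arbitrary island to a window\<close>

text \<open>\<open>x\<close> is the \<open>m\<close>-th point of \<open>J\<close> from the left.
  While at least \<open>k\<close> points lie to the right of \<open>x\<close>, the \<open>m\<close>
  points up to \<open>x\<close> are cut off and replaced further right. Each round raises the lower
  bound \<open>d\<close> on the ranks by at least \<open>m\<close>, whence the quotient.\<close>

lemma near_right_island:
  assumes "J \<in> k_islands P k" "\<And>p. p \<in> J \<Longrightarrow> d \<le> rk p"
  shows "\<exists>J'\<in>k_islands P k. near ((card P - d) div m) J J' \<and>
    (\<exists>x\<in>J'. card {p \<in> J'. rk p < rk x} = m - 1 \<and> card P \<le> rk x + k)"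
  using assms
proof (induction "card P - d" arbitrary: d J rule: less_induct)
  case less
  have J: "island P J" "card J = k" using less.prems(1) by (auto simp: k_islands_def)
  have JP: "J \<subseteq> P" using J(1) by (rule island_imp_subset)
  then have finJ: "finite J" using finite_points finite_subset by blast
  have injJ: "inj_on rk J" using inj_rk JP by (rule inj_on_subset)
  obtain x where x: "x \<in> J" "card {p \<in> J. rk p < rk x} = m - 1"
    using ex_element_of_rank[OF finJ injJ, of "m - 1"] J(2) m_pos m_le by fastforce
  show ?case
  proof (cases "card P \<le> rk x + k")
    case True
    have "near ((card P - d) div m) J J"
      by (rule within_steps_mono[OF within_steps_refl]) simp
    then show ?thesis using True x less.prems(1) by blast
  next
    case False
    define e where "e = Suc (rk x)"
    have e: "e + k \<le> card P" using False by (simp add: e_def)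
    have below: "{p \<in> J. rk p < e} = insert x {p \<in> J. rk p < rk x}"
      using x(1) injJ by (auto simp: e_def less_Suc_eq dest: inj_onD)
    then have cbelow: "card {p \<in> J. rk p < e} = m"
      using x finJ m_pos by simp
    have "{p \<in> J. rk p < e} \<subseteq> slab d e" using less.prems(2) JP by (auto simp: slab_def)
    \<comment> \<open>The \<open>m\<close> points cut off have distinct ranks from \<open>d\<close>
      to \<open>e - 1\<close>.\<close>
    from card_mono[OF finite_slab this] have de: "m \<le> e - d"
      using cbelow e by (simp add: card_slab)
    define G where "G = J \<inter> slab e (card P)"
    have G: "G = J - {p \<in> J. rk p < e}"
      using JP rk_less_card by (auto simp: G_def slab_def)
    then have cardG: "card G = k - m"
      using cbelow finJ J(2) by (simp add: card_Diff_subset)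
    have "G = J \<inter> {z. e \<le> rk z \<and> rk z \<le> card P}"
      using JP rk_less_card by (auto simp: G_def slab_def intro: less_imp_le)
    then have "island P G" using island_Int[OF J(1) convex_rk_slab] by simp
    then obtain J1 where J1: "island P J1" "G \<subseteq> J1" "J1 \<subseteq> slab e (card P)" "card J1 = k"
      using ex_island_between[OF finite_points _ island_slab[of e "card P"], of G k] cardG e
      by (fastforce simp: card_slab G_def)
    have J1k: "J1 \<in> k_islands P k" using J1 by (simp add: k_islands_def)
    have "J \<inter> J1 = G" using J1(2,3) by (auto simp: G_def)
    then have near1: "near 1 J J1" using near_arc[OF less.prems(1) J1k] cardG by simp
    have "\<exists>J'\<in>k_islands P k. near ((card P - e) div m) J1 J' \<and>
      (\<exists>x\<in>J'. card {p \<in> J'. rk p < rk x} = m - 1 \<and> card P \<le> rk x + k)"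
    proof (rule less.hyps)
      show "card P - e < card P - d" using de e m_pos m_le by linarith
      show "J1 \<in> k_islands P k" by fact
      show "e \<le> rk p" if "p \<in> J1" for p using that J1(3) by (auto simp: slab_def)
    qed
    then obtain J' where J': "J' \<in> k_islands P k" "near ((card P - e) div m) J1 J'"
      "\<exists>x\<in>J'. card {p \<in> J'. rk p < rk x} = m - 1 \<and> card P \<le> rk x + k" by blast
    have "card P - e + m \<le> card P - d" using de e m_pos by linarith
    then have "(card P - e + m) div m \<le> (card P - d) div m" by (rule div_le_mono)
    then have "1 + (card P - e) div m \<le> (card P - d) div m" using m_pos by simp
    then have "near ((card P - d) div m) J J'"
      by (rule within_steps_mono[OF within_steps_trans[OF near1 J'(2)]])
    then show ?thesis using J' by blast
  qed
qed

text \<open>A window moved by one position loses one point and gains one. This is the continuity for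
  a discrete intermediate value argument.\<close>

lemma card_Int_window_step:
  assumes "Suc j + k \<le> card P" "finite J"
  shows "\<bar>int (card (J \<inter> window (Suc j))) - int (card (J \<inter> window j))\<bar> \<le> 1"
proof -
  have "J \<inter> window (Suc j) \<subseteq> (J \<inter> window j) \<union> slab (j + k) (Suc (j + k))"
    by (auto simp: slab_def)
  then have "card (J \<inter> window (Suc j)) \<le> card ((J \<inter> window j) \<union> slab (j + k) (Suc (j + k)))"
    using assms finite_slab by (intro card_mono) auto
  also have "\<dots> \<le> card (J \<inter> window j) + 1"
    using card_Un_le[of "J \<inter> window j" "slab (j + k) (Suc (j + k))"] assms by (simp add: card_slab)
  finally have 1: "card (J \<inter> window (Suc j)) \<le> card (J \<inter> window j) + 1" .
  have "J \<inter> window j \<subseteq> (J \<inter> window (Suc j)) \<union> slab j (Suc j)"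
    by (auto simp: slab_def)
  then have "card (J \<inter> window j) \<le> card ((J \<inter> window (Suc j)) \<union> slab j (Suc j))"
    using assms finite_slab by (intro card_mono) auto
  also have "\<dots> \<le> card (J \<inter> window (Suc j)) + 1"
    using card_Un_le[of "J \<inter> window (Suc j)" "slab j (Suc j)"] assms by (simp add: card_slab)
  finally show ?thesis using 1 by linarith
qed

text \<open>Each point of \<open>J\<close> lies in at most \<open>k\<close> of the windows, so double counting incidences
  between \<open>J\<close> and the windows suffices.\<close>

lemma ex_window_few_common:
  assumes J: "J \<in> k_islands P k" and small: "Suc (k - m) < m"
  shows "\<exists>j\<le>card P - k. card (J \<inter> window j) \<le> k - m"
proof (rule ccontr)
  assume "\<not> ?thesis"
  then have many: "Suc (k - m) \<le> card (J \<inter> window j)" if "j \<le> card P - k" for j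
    using that by (meson Suc_leI not_le)
  have cardJ: "card J = k" and finJ: "finite J"
    using J finite_subset[OF island_imp_subset finite_points] by (auto simp: k_islands_def)
  have card_ind: "card (J \<inter> window j) = (\<Sum>p\<in>J. if p \<in> window j then 1 else 0)" for j
    using finJ by (simp add: sum.If_cases)
  have le_k: "(\<Sum>j\<le>card P - k. if p \<in> window j then 1 else 0) \<le> k" for p
  proof -
    have "(\<Sum>j\<le>card P - k. if p \<in> window j then 1 else 0 :: nat) = card ({..card P - k} \<inter> {j. p \<in> window j})"
      by (simp add: sum.If_cases)
    \<comment> \<open>A window containing \<open>p\<close> starts at most \<open>k - 1\<close>
      positions before \<open>p\<close>.\<close>
    also have "\<dots> \<le> card {rk p + 1 - k..rk p}"
      by (intro card_mono) (auto simp: slab_def)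
    also have "\<dots> \<le> k" by simp
    finally show ?thesis .
  qed
  have "(\<Sum>j\<le>card P - k. Suc (k - m)) \<le> (\<Sum>j\<le>card P - k. card (J \<inter> window j))"
    using many by (intro sum_mono) auto
  also have "\<dots> = (\<Sum>p\<in>J. \<Sum>j\<le>card P - k. if p \<in> window j then 1 else 0)"
    unfolding card_ind by (rule sum.swap)
  also have "\<dots> \<le> (\<Sum>p\<in>J. k)" by (rule sum_mono) (rule le_k)
  finally have le: "Suc (card P - k) * Suc (k - m) \<le> k * k"
    using cardJ by simp
  \<comment> \<open>There are at least \<open>m * m + m + 2\<close> windows, and
    \<open>l + 2 \<le> m\<close> makes \<open>(m * m + m + 2) * (l + 1)\<close> exceed
    \<open>(l + m) * (l + m)\<close>.\<close>
  define l where "l = k - m"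
  have k: "k = l + m" and lm: "l + 2 \<le> m" using small m_le by (auto simp: l_def)
  have "(m * m + m + 2) * (l + 1) \<le> Suc (card P - k) * Suc (k - m)"
    using room unfolding l_def[symmetric] by (intro mult_mono) (auto simp: algebra_simps)
  also note le
  finally have "(m * m + m + 2) * (l + 1) \<le> (l + m) * (l + m)" unfolding k .
  moreover have "l * (2 * m) \<le> l * (m * m)" "l * l \<le> l * m"
    using lm by (auto intro!: mult_le_mono2 mult_le_mono1)
  moreover have "(l + m) * (l + m) = l * l + l * (2 * m) + m * m"
    "(m * m + m + 2) * (l + 1) = l * (m * m) + m * m + l * m + m + 2 * l + 2"
    by (simp_all add: algebra_simps)
  ultimately show False by linarith
qed

text \<open>The last window meets \<open>J\<close> in at least \<open>k - m\<close> points and some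
  window in at most \<open>k - m\<close>. Hence a window in between meets it in exactly
  \<open>k - m\<close>.\<close>

lemma near_window_of_right_island:
  assumes J: "J \<in> k_islands P k" and x: "x \<in> J" "card {p \<in> J. rk p < rk x} = m - 1" "card P \<le> rk x + k"
  shows "\<exists>j. j + k \<le> card P \<and> near 1 J (window j)"
proof -
  have JP: "J \<subseteq> P" and cardJ: "card J = k"
    using J island_imp_subset by (auto simp: k_islands_def)
  then have finJ: "finite J" using finite_points finite_subset by blast
  have nk: "k \<le> card P" using room by simp
  have split: "card {p \<in> J. rk p < c} + card {p \<in> J. c \<le> rk p} = k" for c
  proof -
    have "card ({p \<in> J. rk p < c} \<union> {p \<in> J. c \<le> rk p}) = card {p \<in> J. rk p < c} + card {p \<in> J. c \<le> rk p}"
      using finJ by (intro card_Un_disjoint) auto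
    moreover have "{p \<in> J. rk p < c} \<union> {p \<in> J. c \<le> rk p} = J" by auto
    ultimately show ?thesis using cardJ by simp
  qed
  have last: "k - m \<le> card (J \<inter> window (card P - k))"
  proof -
    have "{p \<in> J. rk x \<le> rk p} \<subseteq> J \<inter> window (card P - k)"
      using JP x(3) nk rk_less_card by (auto simp: slab_def)
    from card_mono[OF _ this] show ?thesis using split[of "rk x"] x(2) m_pos finJ by simp
  qed
  have "\<exists>j\<le>card P - k. card (J \<inter> window j) \<le> k - m"
  \<comment> \<open>Double counting settles the first case; in the second one
    \<open>window 0\<close> has few common points with \<open>J\<close>.\<close>
  proof (cases "Suc (k - m) < m")
    case True
    then show ?thesis using ex_window_few_common[OF J] by blast
  next
    case False
    have J0: "J \<inter> window 0 = {p \<in> J. rk p < k}" using JP by (auto simp: slab_def)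
    have "card (J \<inter> window 0) \<le> k - m"
    proof (cases "k \<le> rk x")
      case True
      have "card (J \<inter> window 0) \<le> card {p \<in> J. rk p < rk x}"
        unfolding J0 using True finJ by (intro card_mono) auto
      then show ?thesis using x(2) False by simp
    next
      case xk: False
      \<comment> \<open>Fewer than \<open>m\<close> points from \<open>x\<close> on are missing from
        \<open>J\<close>. As more than \<open>2 * m\<close> points have rank at least
        \<open>k\<close>, at least \<open>m\<close> of them are in \<open>J\<close>.\<close>
      have sub: "{p \<in> J. rk x \<le> rk p} \<subseteq> slab (rk x) (card P)"
        using JP rk_less_card by (auto simp: slab_def)
      have "slab k (card P) \<subseteq> {p \<in> J. k \<le> rk p} \<union> (slab (rk x) (card P) - {p \<in> J. rk x \<le> rk p})"
        using xk by (auto simp: slab_def)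
      then have "card (slab k (card P)) \<le> card ({p \<in> J. k \<le> rk p} \<union> (slab (rk x) (card P) - {p \<in> J. rk x \<le> rk p}))"
        using finJ finite_slab by (intro card_mono) auto
      also have "\<dots> \<le> card {p \<in> J. k \<le> rk p} + card (slab (rk x) (card P) - {p \<in> J. rk x \<le> rk p})"
        by (rule card_Un_le)
      also have "card (slab (rk x) (card P) - {p \<in> J. rk x \<le> rk p}) = card P - rk x - card {p \<in> J. rk x \<le> rk p}"
        using finJ sub by (subst card_Diff_subset) (auto simp: card_slab)
      finally have "card P - k \<le> card {p \<in> J. k \<le> rk p} + (card P - rk x - card {p \<in> J. rk x \<le> rk p})"
        by (simp add: card_slab)
      moreover have "card {p \<in> J. rk x \<le> rk p} = Suc (k - m)"
        using split[of "rk x"] x(2) m_pos m_le by simp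
      moreover have "2 * m \<le> m * (m + 1)" using m_pos by simp
      ultimately have "m \<le> card {p \<in> J. k \<le> rk p}"
        using room x(3) m_le by linarith
      then show ?thesis using split[of k] J0 by simp
    qed
    then show ?thesis by blast
  qed
  then obtain j0 where j0: "j0 \<le> card P - k" "card (J \<inter> window j0) \<le> k - m" by blast
  have "\<exists>j. j0 \<le> j \<and> j \<le> card P - k \<and> int (card (J \<inter> window j)) = int (k - m)"
    using j0 last nk finJ by (intro nat_intermed_int_val allI impI card_Int_window_step) auto
  then obtain j where j: "j \<le> card P - k" "card (J \<inter> window j) = k - m" by auto
  then have "j + k \<le> card P" using nk by simp
  then show ?thesis using near_arc[OF J window_island j(2)] by blast
qed

text \<open>Each island reaches a central window in \<open>2 * (card P div m) + 3\<close> steps, and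
  \<open>6 * m\<close> steps join the two windows.\<close>

lemma near_any:
  assumes "I \<in> k_islands P k" "J \<in> k_islands P k"
  shows "near (4 * (card P div m) + 6 + 6 * m) I J"
proof -
  let ?n = "card P div m"
  have central: "\<exists>w. 2 * m \<le> Suc w \<and> w + 2 \<le> 3 * m \<and> near (?n + (1 + (?n + 2))) K (window w)"
    if "K \<in> k_islands P k" for K
  proof -
    obtain K' x where K': "K' \<in> k_islands P k" "near ((card P - 0) div m) K K'"
      "x \<in> K'" "card {p \<in> K'. rk p < rk x} = m - 1" "card P \<le> rk x + k"
      using near_right_island[of K 0] \<open>K \<in> k_islands P k\<close> by blast
    obtain j where j: "j + k \<le> card P" "near 1 K' (window j)"
      using near_window_of_right_island[OF K'(1,3,4,5)] by blast
    obtain w where w: "2 * m \<le> Suc w" "w + 2 \<le> 3 * m" "near (?n + 2) (window j) (window w)"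
      using near_central_window[OF j(1)] by blast
    have "near (?n + (1 + (?n + 2))) K (window w)"
      using within_steps_trans[OF K'(2) within_steps_trans[OF j(2) w(3)]] by simp
    then show ?thesis using w by blast
  qed
  obtain a where a: "2 * m \<le> Suc a" "a + 2 \<le> 3 * m" "near (?n + (1 + (?n + 2))) I (window a)"
    using central[OF assms(1)] by blast
  obtain b where b: "2 * m \<le> Suc b" "b + 2 \<le> 3 * m" "near (?n + (1 + (?n + 2))) J (window b)"
    using central[OF assms(2)] by blast
  have "near (?n + (1 + (?n + 2)) + (6 * m + (?n + (1 + (?n + 2))))) I J"
    by (rule within_steps_trans[OF a(3) within_steps_trans[OF
      near_central_windows[OF a(1,2) b(1,2)] near_sym[OF b(3)]]])
  then show ?thesis by (rule within_steps_mono) simp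
qed

end

section \<open>Choice of the generic direction\<close>

lemma ex_ranked_points:
  assumes fin: "finite P" and gp: "general_position P"
  shows "\<exists>X Y. ranked_points P X Y"
proof -
  \<comment> \<open>\<open>bad\<close> contains every \<open>\<epsilon>\<close> for which two points
    with different second coordinates get the same \<open>X\<close>.\<close>
  define bad where "bad = (\<lambda>(p, q). - (p $ 1 - q $ 1) / (p $ 2 - q $ 2)) ` (P \<times> P)"
  have "finite bad" using fin by (simp add: bad_def)
  then obtain \<epsilon> :: real where \<epsilon>: "\<epsilon> \<notin> bad"
    using ex_new_if_finite[OF infinite_UNIV_char_0] by blast
  define X :: "real^2 \<Rightarrow> real" where "X z = z $ 1 + \<epsilon> * z $ 2" for z
  define Y :: "real^2 \<Rightarrow> real" where "Y z = z $ 2" for z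
  have "ranked_points P X Y"
  proof (rule ranked_points.intro)
    show "finite P" by fact
    show "linear X" "linear Y"
      unfolding X_def Y_def by (auto intro!: linearI simp: algebra_simps)
    show "inj_on X P"
    proof (rule inj_onI)
      fix p q assume pq: "p \<in> P" "q \<in> P" "X p = X q"
      have "p $ 2 = q $ 2"
      proof (rule ccontr)
        assume ne: "p $ 2 \<noteq> q $ 2"
        have "\<epsilon> * (p $ 2 - q $ 2) = - (p $ 1 - q $ 1)" using pq(3) by (simp add: X_def algebra_simps)
        then have "\<epsilon> = - (p $ 1 - q $ 1) / (p $ 2 - q $ 2)" using ne by (simp add: eq_divide_eq)
        then have "\<epsilon> \<in> bad" using pq by (force simp: bad_def)
        then show False using \<epsilon> by simp
      qed
      then show "p = q" using pq(3) by (simp add: X_def vec_eq_iff forall_2)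
    qed
    show "Y c \<noteq> \<alpha> * X c + \<beta>" if abc: "a \<in> P" "b \<in> P" "c \<in> P" "a \<noteq> b" "a \<noteq> c" "b \<noteq> c"
      and line: "Y a = \<alpha> * X a + \<beta>" "Y b = \<alpha> * X b + \<beta>" for a b c \<alpha> \<beta>
    proof
      assume Yc: "Y c = \<alpha> * X c + \<beta>"
      \<comment> \<open>As \<open>z $ 1 = X z - \<epsilon> * Y z\<close>, this is the direction of
        the line in the original coordinates.\<close>
      define u :: "real^2" where "u = vector [1 - \<epsilon> * \<alpha>, \<alpha>]"
      have "p - q = (X p - X q) *\<^sub>R u" if "Y p = \<alpha> * X p + \<beta>" "Y q = \<alpha> * X q + \<beta>" for p q
      proof -
        have 2: "p $ 2 - q $ 2 = (X p - X q) * \<alpha>" using that by (simp add: Y_def algebra_simps)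
        have "p $ 1 - q $ 1 = (X p - X q) - \<epsilon> * (p $ 2 - q $ 2)" by (simp add: X_def algebra_simps)
        then have "p $ 1 - q $ 1 = (X p - X q) * (1 - \<epsilon> * \<alpha>)" unfolding 2 by (simp add: algebra_simps)
        then show ?thesis using 2 by (simp add: vec_eq_iff forall_2 u_def)
      qed
      then have "collinear {a, b, c}"
        unfolding collinear_def using line Yc by (intro exI[of _ u]) blast
      moreover have "card {a, b, c} = 3" using abc by simp
      ultimately show False
        using gp[unfolded general_position_def, rule_format, of "{a, b, c}"] abc(1-3) by simp
    qed
  qed
  then show ?thesis by blast
qed

theorem theorem1:
  shows "\<exists>C\<^sub>1 C\<^sub>2 :: real. \<forall>(P :: (real^2) set) (n :: nat) (k :: nat) (l :: nat).
    finite P \<and> card P = n \<and> general_position P \<and> l < k \<and> k \<le> n \<and>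
    n > (k - l) * (k - l + 1) + k \<longrightarrow>
      Digraph_Component.connected (with_proj (island_johnson_graph P k l)) \<and>
      graph_diameter (with_proj (island_johnson_graph P k l))
        \<le> ereal (C\<^sub>1 * (real n / real (k - l)) + C\<^sub>2 * real (k - l))"
proof (rule exI[of _ 4], rule exI[of _ 12], intro allI impI, elim conjE)
  fix P :: "(real^2) set" and n k l :: nat
  assume fin: "finite P" and n: "card P = n" and gp: "general_position P" and lk: "l < k"
    and room: "n > (k - l) * (k - l + 1) + k"
  define m where "m = k - l"
  have m: "0 < m" "k - m = l" using lk by (auto simp: m_def)
  obtain X Y where "ranked_points P X Y" using ex_ranked_points[OF fin gp] by blast
  then interpret ranked_points P X Y .
  interpret ranked_island_graph P X Y k m
    using lk room n by unfold_locales (auto simp: m_def)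
  let ?G = "island_johnson_graph P k l" and ?N = "4 * (n div m) + 6 + 6 * m"
  interpret pair_graph ?G using pair_graph_island_johnson_graph[OF fin lk] .
  have verts: "pverts ?G = k_islands P k" and arcs: "parcs ?G = E"
    using m by (auto simp: island_johnson_graph_def E_def)
  have ne: "pverts ?G \<noteq> {}"
    unfolding verts using window_island[of 0] room n by auto
  have near: "within_steps (parcs ?G) ?N I J" if "I \<in> pverts ?G" "J \<in> pverts ?G" for I J
    using near_any[of I J] that n by (simp add: verts arcs)
  have "real (n div m) \<le> real n / real m" by (rule of_nat_div_le_of_nat)
  \<comment> \<open>The additive \<open>6\<close> is absorbed into another \<open>6 * m\<close>,
    which gives the constants \<open>4\<close> and \<open>12\<close>.\<close>
  moreover have "1 \<le> real m" using m by simp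
  ultimately have "real ?N \<le> 4 * (real n / real m) + 12 * real m"
    by simp
  then have "graph_diameter (with_proj ?G) \<le> ereal (4 * (real n / real m) + 12 * real m)"
    using connected_diameter_within_steps(2)[OF ne near] by (meson ereal_less_eq(3) order_trans)
  then show "Digraph_Component.connected (with_proj ?G) \<and>
      graph_diameter (with_proj ?G) \<le> ereal (4 * (real n / real (k - l)) + 12 * real (k - l))"
    using connected_diameter_within_steps(1)[OF ne near] by (simp add: m_def)
qed

end
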